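(* Let $K$ be a field, $n\geq 1$, $R=K[x_1,\ldots,x_n]$, let $\Delta$ be a simplicial complex on the vertex set $[n]=\{1,\ldots,n\}$ such that no $v\in[n]$ belongs to every facet of $\Delta$ (that is, $\Delta=\operatorname{core}(\Delta)$), let $I\subseteq R$ be its Stanley--Reisner ideal, and let $J_1\subseteq R$ be the monomial ideal defined in the context. Then there is a one-to-one correspondence between the set of minimal monomial generators of $J_1$ and the set of maximal free pairs of $\Delta$; in particular, the number of maximal free pairs of $\Delta$ equals the number of minimal monomial generators of $J_1$.
   Context: A simplicial complex $\Delta$ on $[n]$ is a non-empty collection of subsets of $[n]$ (faces) closed under taking subsets; facets are the inclusion-maximal faces. The Stanley--Reisner ideal $I$ is generated by the squarefree monomials $\mathbf{x}_N=\prod_{i\in N}x_i$ with $N\subseteq[n]$, $N\notin\Delta$. $I^{[2]}$ denotes the ideal generated by the squares of the monomials in $I$. $(I^{[2]}:I)=\{f\in R: fI\subseteq I^{[2]}\}$, which is a monomial ideal. $J_1$ is the ideal generated by all monomials lying in $(I^{[2]}:I)$ but not in $I^{[2]}+(x_1\cdots x_n)$ (equivalently, by those minimal monomial generators of $(I^{[2]}:I)$ that do not lie in $I^{[2]}+(x_1\cdots x_n)$); $J_1=0$ if there are none. A free pair of $\Delta$ is a pair $(F,G)$ of non-empty subsets of $[n]$ with $F\cap G=\emptyset$, $F\cup G\in\Delta$, and such that $F\cup G$ equals the intersection of all facets of $\Delta$ containing $F$. Free pairs are partially ordered by $(F,G)\leq(F',G')$ iff $F\supseteq F'$ and $G\subseteq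 G'$. A maximal free pair is a maximal element of this poset. *)

theory Defs
  imports Complex_Main "HOL-Library.Poly_Mapping"
begin

text \<open>
  The polynomial ring \<open>K[x\<^sub>1, ..., x\<^sub>n]\<close> is rendered as \<open>('n \<Rightarrow>\<^sub>0 nat) \<Rightarrow>\<^sub>0 'k\<close>: finitely supported
  families of coefficients indexed by exponent vectors, with the convolution product of
  \<open>Poly_Mapping\<close>. The variables, and likewise the vertex set \<open>[n]\<close>, are indexed by a finite type
  \<open>'n\<close>, so that \<open>n = CARD('n) \<ge> 1\<close>.
\<close>

type_synonym ('n, 'k) poly_ring = "('n \<Rightarrow>\<^sub>0 nat) \<Rightarrow>\<^sub>0 'k"

definition simplicial_complex :: "'n set set \<Rightarrow> bool" where
  "simplicial_complex \<Delta> \<longleftrightarrow> \<Delta> \<noteq> {} \<and> (\<forall>F\<in>\<Delta>. \<forall>G. G \<subseteq> F \<longrightarrow> G \<in> \<Delta>)"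

definition facets :: "'n set set \<Rightarrow> 'n set set" where
  "facets \<Delta> = {F \<in> \<Delta>. \<forall>G\<in>\<Delta>. F \<subseteq> G \<longrightarrow> G = F}"

text \<open>Ideals of a commutative ring are the submodules of the ring acting on itself.\<close>

definition ideal_gen :: "'r::comm_ring_1 set \<Rightarrow> 'r set" where
  "ideal_gen B = module.span (*) B"

definition ideal_sum :: "'r::comm_ring_1 set \<Rightarrow> 'r set \<Rightarrow> 'r set" where
  "ideal_sum A B = {a + b | a b. a \<in> A \<and> b \<in> B}"

definition ideal_colon :: "'r::comm_ring_1 set \<Rightarrow> 'r set \<Rightarrow> 'r set" where
  "ideal_colon A B = {f. \<forall>g\<in>B. f * g \<in> A}"

definition Var :: "'n \<Rightarrow> ('n, 'k::comm_ring_1) poly_ring" where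
  "Var i = Poly_Mapping.single (Poly_Mapping.single i 1) 1"

definition monomials :: "('n, 'k::comm_ring_1) poly_ring set" where
  "monomials = range (\<lambda>a. Poly_Mapping.single a 1)"

definition SR_ideal :: "'n::finite set set \<Rightarrow> ('n, 'k::field) poly_ring set" where
  "SR_ideal \<Delta> = ideal_gen {\<Prod>i\<in>N. Var i | N. N \<notin> \<Delta>}"

definition square_ideal :: "('n, 'k::field) poly_ring set \<Rightarrow> ('n, 'k) poly_ring set" where
  "square_ideal I = ideal_gen {m\<^sup>2 | m. m \<in> monomials \<and> m \<in> I}"

definition J1 :: "'n::finite set set \<Rightarrow> ('n, 'k::field) poly_ring set" where
  "J1 \<Delta> = ideal_gen {m \<in> monomials.
     m \<in> ideal_colon (square_ideal (SR_ideal \<Delta>)) (SR_ideal \<Delta>) \<and>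
     m \<notin> ideal_sum (square_ideal (SR_ideal \<Delta>)) (ideal_gen {\<Prod>i\<in>UNIV. Var i})}"

text \<open>
  The following is intended for monomial ideals \<open>J\<close>; the lemma
  \<open>unique_minimal_monomial_generating_set\<close> below shows that for these it is the unique minimal
  generating set consisting of monomials.
\<close>

definition minimal_monomial_generators ::
    "('n, 'k::field) poly_ring set \<Rightarrow> ('n, 'k) poly_ring set" where
  "minimal_monomial_generators J =
     {m \<in> monomials \<inter> J. \<forall>m'\<in>monomials \<inter> J. m' dvd m \<longrightarrow> m' = m}"

definition free_pairs :: "'n set set \<Rightarrow> ('n set \<times> 'n set) set" where
  "free_pairs \<Delta> = {(F, G). F \<noteq> {} \<and> G \<noteq> {} \<and> F \<inter> G = {} \<and> F \<union> G \<in> \<Delta> \<and>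
     F \<union> G = \<Inter>{H \<in> facets \<Delta>. F \<subseteq> H}}"

definition pair_le :: "'n set \<times> 'n set \<Rightarrow> 'n set \<times> 'n set \<Rightarrow> bool" where
  "pair_le p q \<longleftrightarrow> fst q \<subseteq> fst p \<and> snd p \<subseteq> snd q"

definition maximal_free_pairs :: "'n set set \<Rightarrow> ('n set \<times> 'n set) set" where
  "maximal_free_pairs \<Delta> = {p \<in> free_pairs \<Delta>. \<forall>q\<in>free_pairs \<Delta>. pair_le p q \<longrightarrow> q = p}"


lemma module_mult_self: "module ((*) :: 'r::comm_ring_1 \<Rightarrow> 'r \<Rightarrow> 'r)"
  by unfold_locales (simp_all add: algebra_simps)

lemma monomial_in_monomial_ideal:
  fixes B :: "('n, 'k::field) poly_ring set"
  assumes B: "B \<subseteq> monomials" and m: "m \<in> monomials" "m \<in> ideal_gen B"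
  shows "\<exists>b\<in>B. b dvd m"
proof -
  interpret module "(*) :: ('n, 'k) poly_ring \<Rightarrow> _ \<Rightarrow> _"
    by (rule module_mult_self)
  let ?S = "{p :: ('n, 'k) poly_ring. \<forall>a\<in>Poly_Mapping.keys p.
               \<exists>b c. Poly_Mapping.single b 1 \<in> B \<and> a = b + c}"
  have "subspace ?S"
  proof (rule subspaceI)
    show "p + q \<in> ?S" if "p \<in> ?S" "q \<in> ?S" for p q
      using that Poly_Mapping.keys_add[of p q] by blast
    show "c * p \<in> ?S" if p: "p \<in> ?S" for c p
    proof safe
      fix a assume "a \<in> Poly_Mapping.keys (c * p)"
      then obtain u v where uv: "a = u + v" "v \<in> Poly_Mapping.keys p"
        using Poly_Mapping.keys_mult[of c p] by blast
      then obtain b d where "Poly_Mapping.single b 1 \<in> B" "v = b + d"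
        using p by blast
      then show "\<exists>b c. Poly_Mapping.single b 1 \<in> B \<and> a = b + c"
        using uv by (metis add.left_commute)
    qed
  qed simp
  moreover have "B \<subseteq> ?S"
  proof safe
    fix p a assume "p \<in> B" "a \<in> Poly_Mapping.keys p"
    moreover obtain b where "p = Poly_Mapping.single b 1"
      using B \<open>p \<in> B\<close> by (auto simp: monomials_def)
    ultimately show "\<exists>b c. Poly_Mapping.single b 1 \<in> B \<and> a = b + c"
      using \<open>p \<in> B\<close> by (intro exI[of _ b] exI[of _ 0]) (auto split: if_splits)
  qed
  ultimately have "m \<in> ?S"
    using m(2) span_minimal unfolding ideal_gen_def by blast
  moreover obtain a where a: "m = Poly_Mapping.single a 1"
    using m(1) by (auto simp: monomials_def)
  ultimately obtain b c where bc: "Poly_Mapping.single b 1 \<in> B" "a = b + c"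
    by auto
  have "m = Poly_Mapping.single b 1 * Poly_Mapping.single c 1"
    by (simp add: a bc mult_single)
  with bc show ?thesis by (metis dvd_triv_left)
qed

lemma monomial_dvd_antisym:
  fixes m m' :: "('n, 'k::field) poly_ring"
  assumes "m \<in> monomials" "m' \<in> monomials" "m dvd m'" "m' dvd m"
  shows "m = m'"
proof -
  have *: "\<exists>c. a = b + c"
    if dvd: "Poly_Mapping.single b 1 dvd (Poly_Mapping.single a 1 :: ('n, 'k) poly_ring)" for a b
  proof -
    from dvd obtain p :: "('n, 'k) poly_ring"
      where "Poly_Mapping.single a 1 = Poly_Mapping.single b 1 * p" ..
    then have "a \<in> Poly_Mapping.keys (Poly_Mapping.single b 1 * p)"
      by (metis keys_single singletonI zero_neq_one)
    then show ?thesis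
      using Poly_Mapping.keys_mult[of "Poly_Mapping.single b 1" p] by (auto split: if_splits)
  qed
  obtain a b where ab: "m = Poly_Mapping.single a 1" "m' = Poly_Mapping.single b 1"
    using assms by (auto simp: monomials_def)
  with assms * obtain c d where "a = b + c" "b = a + d" by metis
  then have "Poly_Mapping.lookup a i = Poly_Mapping.lookup b i" for i
    by (metis add_leE lookup_add order_antisym order_refl)
  then show ?thesis using ab poly_mapping_eqI by metis
qed

lemma minimal_monomial_divisor:
  fixes m :: "('n::finite, 'k::field) poly_ring"
  assumes "m \<in> monomials" "m \<in> J"
  shows "\<exists>b\<in>minimal_monomial_generators J. b dvd m"
proof -
  let ?deg = "\<lambda>a :: 'n \<Rightarrow>\<^sub>0 nat. \<Sum>i\<in>UNIV. Poly_Mapping.lookup a i"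
  let ?mon = "\<lambda>a. Poly_Mapping.single a 1 :: ('n, 'k) poly_ring"
  have "\<exists>b\<in>minimal_monomial_generators J. b dvd ?mon a" if "?mon a \<in> J" for a
    using that
  proof (induction "?deg a" arbitrary: a rule: less_induct)
    case less
    show ?case
    proof (cases "?mon a \<in> minimal_monomial_generators J")
      case True
      then show ?thesis by (rule bexI[rotated]) (rule dvd_refl)
    next
      case False
      then obtain m' where m': "m' \<in> monomials" "m' \<in> J" "m' dvd ?mon a" "m' \<noteq> ?mon a"
        using less.prems by (auto simp: minimal_monomial_generators_def monomials_def)
      then obtain b where b: "m' = ?mon b" by (auto simp: monomials_def)
      obtain p where "?mon a = ?mon b * p" using m'(3) b by auto
      then have "a \<in> Poly_Mapping.keys (?mon b * p)"
        by (metis keys_single singletonI zero_neq_one)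
      then obtain c where c: "a = b + c"
        using Poly_Mapping.keys_mult[of "?mon b" p] by (auto split: if_splits)
      with m'(4) b obtain i where "Poly_Mapping.lookup c i \<noteq> 0"
        by (metis add.right_neutral poly_mapping_eqI lookup_zero)
      then have "?deg c > 0"
        by (metis (mono_tags) UNIV_I finite gr0I sum_eq_0_iff)
      then have "?deg b < ?deg a" by (simp add: c lookup_add sum.distrib)
      then show ?thesis using less.hyps m' b dvd_trans by blast
    qed
  qed
  with assms show ?thesis by (auto simp: monomials_def)
qed

lemma unique_minimal_monomial_generating_set:
  fixes J :: "('n::finite, 'k::field) poly_ring set"
  assumes J: "J = ideal_gen A" "A \<subseteq> monomials"
  shows "minimal_monomial_generators J \<subseteq> monomials"
    and "ideal_gen (minimal_monomial_generators J) = J"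
    and "\<And>B. B \<subseteq> monomials \<Longrightarrow> ideal_gen B = J \<Longrightarrow> minimal_monomial_generators J \<subseteq> B"
proof -
  interpret module "(*) :: ('n, 'k) poly_ring \<Rightarrow> _ \<Rightarrow> _"
    by (rule module_mult_self)
  let ?M = "minimal_monomial_generators J"
  show M: "?M \<subseteq> monomials" by (auto simp: minimal_monomial_generators_def)
  have "A \<subseteq> ideal_gen ?M"
  proof
    fix a assume "a \<in> A"
    then have "a \<in> monomials" "a \<in> J" using J by (auto simp: ideal_gen_def span_base)
    then obtain b where b: "b \<in> ?M" "b dvd a" using minimal_monomial_divisor by blast
    then obtain p where "a = p * b" by (metis dvdE mult.commute)
    then show "a \<in> ideal_gen ?M" using b by (simp add: ideal_gen_def span_base span_scale)
  qed
  moreover have "?M \<subseteq> J" by (auto simp: minimal_monomial_generators_def)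
  ultimately show "ideal_gen ?M = J"
    using J(1) by (metis ideal_gen_def span_eq)
  show "?M \<subseteq> B" if B: "B \<subseteq> monomials" "ideal_gen B = J" for B
  proof
    fix m assume m: "m \<in> ?M"
    then obtain b where b: "b \<in> B" "b dvd m"
      using monomial_in_monomial_ideal[OF B(1)] B(2)
      by (auto simp: minimal_monomial_generators_def)
    then have "b \<in> monomials \<inter> J" using B by (auto simp: ideal_gen_def span_base)
    with m b show "m \<in> B" by (auto simp: minimal_monomial_generators_def)
  qed
qed

end

theory Submission
  imports Defs
begin

text \<open>
  For an exponent vector \<open>a\<close> put \<open>A = {i. a\<^sub>i \<ge> 2}\<close> and \<open>C = {i. a\<^sub>i = 0}\<close>. The monomial with exponent
  \<open>a\<close> lies in \<open>I\<^sup>[\<^sup>2\<^sup>]\<close> iff \<open>A\<close> is not a face. If \<open>A\<close> is a face, it lies in \<open>(I\<^sup>[\<^sup>2\<^sup>] : I)\<close> iff every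
  facet containing \<open>A\<close> contains \<open>C\<close>. Divisibility of monomials with exponents at most 2 is the
  reverse of the order on pairs \<open>(A, C)\<close>, and for given \<open>A\<close> the largest admissible \<open>C\<close> is the one
  making \<open>(A, C)\<close> a free pair. Hence the maximal free pairs \<open>(F, G)\<close> correspond to the
  minimal generators, with exponent 2 on \<open>F\<close>, 0 on \<open>G\<close> and 1 elsewhere. The core hypothesis
  guarantees that \<open>A\<close> is non-empty.
\<close>

section \<open>Divisibility of monomials and membership in monomial ideals\<close>

lemma single_dvd_single_iff:
  "Poly_Mapping.single b 1 dvd (Poly_Mapping.single a 1 :: ('n::finite, 'k::field) poly_ring) \<longleftrightarrow>
     (\<forall>i. Poly_Mapping.lookup b i \<le> Poly_Mapping.lookup a i)"
  (is "?b dvd ?a \<longleftrightarrow> ?R")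
proof
  assume "?b dvd ?a"
  then obtain p where "?a = ?b * p" ..
  then have "a \<in> Poly_Mapping.keys (?b * p)"
    by (metis keys_single singletonI zero_neq_one)
  then obtain c where "a = b + c"
    using Poly_Mapping.keys_mult[of ?b p] by (auto split: if_splits)
  then show ?R by (simp add: lookup_add)
next
  assume R: ?R
  \<comment> \<open>Subtraction of exponents is truncated, so this identity needs \<open>b\<close>
    to be pointwise at most \<open>a\<close>.\<close>
  have "b + (a - b) = a"
    by (rule poly_mapping_eqI) (use R in \<open>simp add: lookup_add lookup_minus\<close>)
  then have "?a = ?b * Poly_Mapping.single (a - b) 1"
    by (simp add: mult_single)
  then show "?b dvd ?a" ..
qed

lemma single_eq_single_iff:
  "Poly_Mapping.single b 1 = (Poly_Mapping.single a 1 :: ('n, 'k::field) poly_ring) \<longleftrightarrow> b = a"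
  by (metis keys_single singleton_inject zero_neq_one)

lemma ideal_gen_base: "x \<in> B \<Longrightarrow> x \<in> ideal_gen B"
  unfolding ideal_gen_def by (rule module.span_base[OF module_mult_self])

lemma ideal_gen_dvd:
  assumes "b \<in> ideal_gen B" "b dvd x"
  shows "x \<in> ideal_gen B"
proof -
  obtain p where "x = p * b" using assms(2) by (metis dvdE mult.commute)
  then show ?thesis
    using assms(1) module.span_scale[OF module_mult_self] unfolding ideal_gen_def by metis
qed

lemma monomial_in_ideal_gen_iff:
  fixes B :: "('n, 'k::field) poly_ring set"
  assumes "B \<subseteq> monomials" "m \<in> monomials"
  shows "m \<in> ideal_gen B \<longleftrightarrow> (\<exists>b\<in>B. b dvd m)"
  using monomial_in_monomial_ideal[OF assms] ideal_gen_dvd ideal_gen_base by blast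

lemma single_in_monomials: "Poly_Mapping.single a 1 \<in> monomials"
  by (simp add: monomials_def)

section \<open>Monomials in the Stanley--Reisner ideal and in its ideal of squares\<close>

definition indicator_exponent :: "'n::finite set \<Rightarrow> 'n \<Rightarrow>\<^sub>0 nat" where
  "indicator_exponent N = (\<Sum>i\<in>N. Poly_Mapping.single i 1)"

lemma lookup_indicator_exponent:
  "Poly_Mapping.lookup (indicator_exponent N) i = (if i \<in> N then 1 else 0)"
  by (simp add: indicator_exponent_def lookup_sum lookup_single when_def)

lemma prod_Var:
  fixes N :: "'n::finite set"
  shows "(\<Prod>i\<in>N. Var i :: ('n, 'k::field) poly_ring) =
    Poly_Mapping.single (indicator_exponent N) 1"
proof -
  have "finite N" by simp
  then show ?thesis
    by induction (simp_all add: Var_def mult_single indicator_exponent_def)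
qed

lemma SR_ideal_generators_monomials:
  "{\<Prod>i\<in>N. Var i | N. N \<notin> \<Delta>} \<subseteq> (monomials :: ('n::finite, 'k::field) poly_ring set)"
  by (auto simp: prod_Var single_in_monomials)

lemma single_in_SR_ideal_iff:
  fixes \<Delta> :: "'n::finite set set"
  assumes "simplicial_complex \<Delta>"
  shows "Poly_Mapping.single a 1 \<in> (SR_ideal \<Delta> :: ('n, 'k::field) poly_ring set) \<longleftrightarrow>
    {i. Poly_Mapping.lookup a i \<noteq> 0} \<notin> \<Delta>"
    (is "_ \<longleftrightarrow> ?S \<notin> \<Delta>")
proof -
  have "Poly_Mapping.single a 1 \<in> (SR_ideal \<Delta> :: ('n, 'k::field) poly_ring set) \<longleftrightarrow>
      (\<exists>N. N \<notin> \<Delta> \<and> (\<forall>i. (if i \<in> N then 1 else 0) \<le> Poly_Mapping.lookup a i))"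
    unfolding SR_ideal_def
      monomial_in_ideal_gen_iff[OF SR_ideal_generators_monomials single_in_monomials]
    \<comment> \<open>The inequalities on the right are folded back into divisibility by squarefree
      monomials. The coefficient field is fixed by hand, since inequalities between exponents do not
      determine it.\<close>
    unfolding prod_Var lookup_indicator_exponent[symmetric]
      single_dvd_single_iff[where 'k='k, symmetric]
    by blast
  also have "\<dots> \<longleftrightarrow> (\<exists>N. N \<notin> \<Delta> \<and> N \<subseteq> ?S)"
    by (intro ex_cong1 conj_cong refl) (auto simp: Suc_le_eq)
  also have "\<dots> \<longleftrightarrow> ?S \<notin> \<Delta>"
    using assms unfolding simplicial_complex_def by blast
  finally show ?thesis .
qed

lemma square_ideal_generators_monomials:
  "{m\<^sup>2 | m. m \<in> monomials \<and> m \<in> I} \<subseteq> (monomials :: ('n, 'k::field) poly_ring set)"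
  by (auto simp: monomials_def power2_eq_square mult_single)

text \<open>A square with exponent \<open>b + b\<close> divides the monomial only if the support of
  \<open>b\<close> lies in \<open>?S\<close>. Non-faces are closed under supersets, so it is enough
  to test the largest such support, \<open>?S\<close> itself.\<close>

lemma single_in_square_ideal_iff:
  fixes \<Delta> :: "'n::finite set set"
  assumes "simplicial_complex \<Delta>"
  shows "Poly_Mapping.single a 1 \<in> square_ideal (SR_ideal \<Delta> :: ('n, 'k::field) poly_ring set) \<longleftrightarrow>
    {i. 2 \<le> Poly_Mapping.lookup a i} \<notin> \<Delta>"
    (is "?L \<longleftrightarrow> ?S \<notin> \<Delta>")
proof -
  have gens: "{m\<^sup>2 | m. m \<in> monomials \<and> m \<in> (SR_ideal \<Delta> :: ('n, 'k) poly_ring set)} =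
      {Poly_Mapping.single (b + b) 1 | b. {i. Poly_Mapping.lookup b i \<noteq> 0} \<notin> \<Delta>}"
    unfolding single_in_SR_ideal_iff[OF assms, where 'k='k, symmetric]
    by (force simp: monomials_def power2_eq_square mult_single)
  have "?L \<longleftrightarrow> (\<exists>b. {i. Poly_Mapping.lookup b i \<noteq> 0} \<notin> \<Delta> \<and>
      (Poly_Mapping.single (b + b) 1 :: ('n, 'k) poly_ring) dvd Poly_Mapping.single a 1)"
    unfolding square_ideal_def
      monomial_in_ideal_gen_iff[OF square_ideal_generators_monomials single_in_monomials]
    unfolding gens by blast
  also have "\<dots> \<longleftrightarrow> (\<exists>b. {i. Poly_Mapping.lookup b i \<noteq> 0} \<notin> \<Delta> \<and>
      (\<forall>i. 2 * Poly_Mapping.lookup b i \<le> Poly_Mapping.lookup a i))"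
    by (simp only: single_dvd_single_iff lookup_add mult_2)
  also have "\<dots> \<longleftrightarrow> ?S \<notin> \<Delta>"
  proof
    assume "\<exists>b. {i. Poly_Mapping.lookup b i \<noteq> 0} \<notin> \<Delta> \<and>
      (\<forall>i. 2 * Poly_Mapping.lookup b i \<le> Poly_Mapping.lookup a i)"
    then obtain b where b: "{i. Poly_Mapping.lookup b i \<noteq> 0} \<notin> \<Delta>"
      "\<And>i. 2 * Poly_Mapping.lookup b i \<le> Poly_Mapping.lookup a i" by blast
    have "2 \<le> Poly_Mapping.lookup a i" if "Poly_Mapping.lookup b i \<noteq> 0" for i
      using b(2)[of i] that by linarith
    then have "{i. Poly_Mapping.lookup b i \<noteq> 0} \<subseteq> ?S" by blast
    then show "?S \<notin> \<Delta>" using b(1) assms unfolding simplicial_complex_def by blast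
  next
    assume "?S \<notin> \<Delta>"
    then show "\<exists>b. {i. Poly_Mapping.lookup b i \<noteq> 0} \<notin> \<Delta> \<and>
      (\<forall>i. 2 * Poly_Mapping.lookup b i \<le> Poly_Mapping.lookup a i)"
      \<comment> \<open>The witness is the squarefree monomial on \<open>?S\<close>; its square has
        exponent 2 exactly where \<open>a\<close> is at least 2.\<close>
      by (intro exI[of _ "indicator_exponent ?S"]) (simp add: lookup_indicator_exponent)
  qed
  finally show ?thesis .
qed

section \<open>The colon ideal and the sum with the product of all variables\<close>

lemma ideal_colon_ideal_gen:
  "x \<in> ideal_colon (ideal_gen A) (ideal_gen B) \<longleftrightarrow> (\<forall>b\<in>B. x * b \<in> ideal_gen A)"
proof
  show "\<forall>b\<in>B. x * b \<in> ideal_gen A" if "x \<in> ideal_colon (ideal_gen A) (ideal_gen B)"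
    using that by (auto simp: ideal_colon_def ideal_gen_base)
next
  assume *: "\<forall>b\<in>B. x * b \<in> ideal_gen A"
  interpret module "(*) :: 'a \<Rightarrow> _ \<Rightarrow> _" by (rule module_mult_self)
  \<comment> \<open>The elements that \<open>x\<close> multiplies into a given ideal form an ideal,
    so containing the generators of \<open>B\<close> forces it to contain their span.\<close>
  have "subspace {g. x * g \<in> span A}"
  proof (rule subspaceI; unfold mem_Collect_eq)
    show "x * 0 \<in> span A" by (simp add: span_zero)
    show "x * (g + h) \<in> span A" if "x * g \<in> span A" "x * h \<in> span A" for g h
      using span_add[OF that] by (simp only: distrib_left)
    show "x * (c * g) \<in> span A" if "x * g \<in> span A" for c g
      using span_scale[OF that, of c] by (simp only: mult.left_commute[of x c g])
  qed
  moreover have "B \<subseteq> {g. x * g \<in> span A}" using * by (auto simp only: ideal_gen_def)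
  ultimately have "span B \<subseteq> {g. x * g \<in> span A}" by (metis span_minimal)
  then show "x \<in> ideal_colon (ideal_gen A) (ideal_gen B)"
    unfolding ideal_colon_def ideal_gen_def by (simp only: subset_iff mem_Collect_eq) simp
qed

lemma ideal_sum_ideal_gen: "ideal_sum (ideal_gen A) (ideal_gen B) = ideal_gen (A \<union> B)"
  unfolding ideal_sum_def ideal_gen_def module.span_Un[OF module_mult_self] ..

text \<open>It suffices to multiply by the generators of the Stanley--Reisner ideal. Such a product
  raises the exponents on \<open>N\<close> by one, so the positions with exponent at least 2 are the
  old ones together with those of \<open>N\<close> where the exponent was already positive.\<close>

lemma single_in_ideal_colon_iff:
  fixes \<Delta> :: "'n::finite set set"
  assumes "simplicial_complex \<Delta>"
  shows "Poly_Mapping.single a 1 \<in>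
      ideal_colon (square_ideal (SR_ideal \<Delta>)) (SR_ideal \<Delta> :: ('n, 'k::field) poly_ring set) \<longleftrightarrow>
    (\<forall>N. N \<notin> \<Delta> \<longrightarrow> {i. 2 \<le> Poly_Mapping.lookup a i} \<union>
      ({i. Poly_Mapping.lookup a i \<noteq> 0} \<inter> N) \<notin> \<Delta>)"
proof -
  let ?I = "SR_ideal \<Delta> :: ('n, 'k) poly_ring set"
  let ?A = "{m\<^sup>2 | m. m \<in> monomials \<and> m \<in> ?I}"
  let ?B = "{\<Prod>i\<in>N. Var i | N. N \<notin> \<Delta>} :: ('n, 'k) poly_ring set"
  have mult: "Poly_Mapping.single a 1 * (\<Prod>i\<in>N. Var i :: ('n, 'k) poly_ring) =
      Poly_Mapping.single (a + indicator_exponent N) 1" for N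
    by (simp add: prod_Var mult_single)
  have "Poly_Mapping.single a 1 \<in> ideal_colon (square_ideal ?I) ?I \<longleftrightarrow>
      Poly_Mapping.single a 1 \<in> ideal_colon (ideal_gen ?A) (ideal_gen ?B)"
    by (simp only: square_ideal_def SR_ideal_def)
  also have "\<dots> \<longleftrightarrow> (\<forall>b\<in>?B. Poly_Mapping.single a 1 * b \<in> square_ideal ?I)"
    unfolding square_ideal_def by (rule ideal_colon_ideal_gen)
  also have "\<dots> \<longleftrightarrow> (\<forall>N. N \<notin> \<Delta> \<longrightarrow>
      Poly_Mapping.single (a + indicator_exponent N) 1 \<in> square_ideal ?I)"
    unfolding mult[symmetric] by blast
  also have "\<dots> \<longleftrightarrow> (\<forall>N. N \<notin> \<Delta> \<longrightarrow>
      {i. 2 \<le> Poly_Mapping.lookup (a + indicator_exponent N) i} \<notin> \<Delta>)"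
    by (simp add: single_in_square_ideal_iff[OF assms])
  moreover have "{i. 2 \<le> Poly_Mapping.lookup (a + indicator_exponent N) i} =
      {i. 2 \<le> Poly_Mapping.lookup a i} \<union> ({i. Poly_Mapping.lookup a i \<noteq> 0} \<inter> N)" for N
    by (auto simp: lookup_add lookup_indicator_exponent split: if_splits)
  ultimately show ?thesis by simp
qed

lemma single_in_ideal_sum_iff:
  fixes \<Delta> :: "'n::finite set set"
  assumes "simplicial_complex \<Delta>"
  shows "Poly_Mapping.single a 1 \<in> ideal_sum (square_ideal (SR_ideal \<Delta>))
      (ideal_gen {\<Prod>i\<in>UNIV. Var i :: ('n, 'k::field) poly_ring}) \<longleftrightarrow>
    {i. 2 \<le> Poly_Mapping.lookup a i} \<notin> \<Delta> \<or> {i. Poly_Mapping.lookup a i = 0} = {}"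
    (is "?a \<in> ideal_sum ?I (ideal_gen ?V) \<longleftrightarrow> _")
proof -
  let ?A = "{m\<^sup>2 | m. m \<in> monomials \<and> m \<in> (SR_ideal \<Delta> :: ('n, 'k::field) poly_ring set)}"
  have V: "?V \<subseteq> monomials" by (auto simp: prod_Var single_in_monomials)
  have "?a \<in> ideal_sum ?I (ideal_gen ?V) \<longleftrightarrow> (\<exists>b\<in>?A \<union> ?V. b dvd ?a)"
    unfolding square_ideal_def ideal_sum_ideal_gen
    by (rule monomial_in_ideal_gen_iff[OF Un_least[OF square_ideal_generators_monomials V]
          single_in_monomials])
  also have "\<dots> \<longleftrightarrow> (\<exists>b\<in>?A. b dvd ?a) \<or> (\<exists>b\<in>?V. b dvd ?a)"
    by (rule bex_Un)
  also have "(\<exists>b\<in>?A. b dvd ?a) \<longleftrightarrow> ?a \<in> ?I"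
    unfolding square_ideal_def
    by (rule monomial_in_ideal_gen_iff[OF square_ideal_generators_monomials
          single_in_monomials, symmetric])
  also have "(\<exists>b\<in>?V. b dvd ?a) \<longleftrightarrow> {i. Poly_Mapping.lookup a i = 0} = {}"
    by (simp add: prod_Var single_dvd_single_iff lookup_indicator_exponent Suc_le_eq)
  finally show ?thesis by (simp add: single_in_square_ideal_iff[OF assms])
qed

section \<open>Facets, closures of faces and free pairs\<close>

lemma face_in_facet:
  fixes \<Delta> :: "'n::finite set set"
  assumes "F \<in> \<Delta>"
  obtains H where "H \<in> facets \<Delta>" "F \<subseteq> H"
proof -
  obtain H where H: "H \<in> \<Delta>" "F \<subseteq> H" "\<And>G. G \<in> \<Delta> \<Longrightarrow> H \<subseteq> G \<Longrightarrow> H = G"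
    using finite_has_maximal2[of \<Delta> F] assms by auto
  then have "H \<in> facets \<Delta>" by (auto simp: facets_def)
  with H(2) that show thesis by blast
qed

text \<open>Turns the colon condition, with \<open>A\<close> the exponents at least 2 and
  \<open>C\<close> the zero exponents, into a statement about facets alone.\<close>

lemma colon_condition_iff:
  fixes \<Delta> :: "'n::finite set set"
  assumes \<Delta>: "simplicial_complex \<Delta>" and A: "A \<in> \<Delta>" and AC: "A \<inter> C = {}"
  shows "(\<forall>N. N \<notin> \<Delta> \<longrightarrow> A \<union> (- C \<inter> N) \<notin> \<Delta>) \<longleftrightarrow>
    C \<subseteq> \<Inter>{H \<in> facets \<Delta>. A \<subseteq> H}"
proof
  assume L: "\<forall>N. N \<notin> \<Delta> \<longrightarrow> A \<union> (- C \<inter> N) \<notin> \<Delta>"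
  have "C \<subseteq> H" if H: "H \<in> facets \<Delta>" "A \<subseteq> H" for H
  proof -
    \<comment> \<open>The hypothesis is tested at \<open>N = H \<union> C\<close>: removing
      \<open>C\<close> leaves a subset of the face \<open>H\<close>, so \<open>H \<union> C\<close>
      is a face, and maximality of \<open>H\<close> absorbs \<open>C\<close>.\<close>
    have "A \<union> (- C \<inter> (H \<union> C)) \<subseteq> H" using H(2) by blast
    then have "A \<union> (- C \<inter> (H \<union> C)) \<in> \<Delta>"
      using \<Delta> H(1) unfolding simplicial_complex_def facets_def by blast
    then have "H \<union> C \<in> \<Delta>" using L by blast
    then have "H \<union> C = H" using H(1) by (auto simp: facets_def)
    then show ?thesis by blast
  qed
  then show "C \<subseteq> \<Inter>{H \<in> facets \<Delta>. A \<subseteq> H}" by blast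
next
  assume R: "C \<subseteq> \<Inter>{H \<in> facets \<Delta>. A \<subseteq> H}"
  have "N \<in> \<Delta>" if N: "A \<union> (- C \<inter> N) \<in> \<Delta>" for N
  proof -
    obtain H where H: "H \<in> facets \<Delta>" "A \<union> (- C \<inter> N) \<subseteq> H" using face_in_facet[OF N] .
    then have "C \<subseteq> H" using R by blast
    then have "N \<subseteq> H" using H(2) by blast
    then show ?thesis using H(1) \<Delta> unfolding simplicial_complex_def facets_def by blast
  qed
  then show "\<forall>N. N \<notin> \<Delta> \<longrightarrow> A \<union> (- C \<inter> N) \<notin> \<Delta>" by blast
qed

text \<open>The pairs coming from the monomials that generate \<open>J1\<close>. Compared with free
  pairs, \<open>A\<close> may be empty and \<open>A \<union> C\<close> may be smaller than the
  intersection of the facets containing \<open>A\<close>.\<close>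

definition subfree_pairs :: "'n set set \<Rightarrow> ('n set \<times> 'n set) set" where
  "subfree_pairs \<Delta> = {(A, C). A \<in> \<Delta> \<and> C \<noteq> {} \<and> A \<inter> C = {} \<and> C \<subseteq> \<Inter>{H \<in> facets \<Delta>. A \<subseteq> H}}"

lemma free_pairs_subset_subfree_pairs:
  assumes "simplicial_complex \<Delta>"
  shows "free_pairs \<Delta> \<subseteq> subfree_pairs \<Delta>"
proof safe
  fix F G assume "(F, G) \<in> free_pairs \<Delta>"
  then have FG: "G \<noteq> {}" "F \<inter> G = {}" "F \<union> G \<in> \<Delta>" "F \<union> G = \<Inter>{H \<in> facets \<Delta>. F \<subseteq> H}"
    unfolding free_pairs_def mem_Collect_eq prod.case by iprover+
  have "F \<in> \<Delta>" using FG(3) assms unfolding simplicial_complex_def by blast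
  moreover have "G \<subseteq> \<Inter>{H \<in> facets \<Delta>. F \<subseteq> H}" unfolding FG(4)[symmetric] by blast
  ultimately show "(F, G) \<in> subfree_pairs \<Delta>"
    using FG(1,2) by (simp add: subfree_pairs_def)
qed

text \<open>Keeping \<open>A\<close> and enlarging \<open>C\<close> to the rest of the intersection
  of the facets containing \<open>A\<close> produces a free pair. Hence maximality among free pairs
  also controls the larger poset of subfree pairs.\<close>

lemma subfree_pair_le_free_pair:
  fixes \<Delta> :: "'n::finite set set"
  assumes \<Delta>: "simplicial_complex \<Delta>" and core: "\<not> (\<exists>v. \<forall>F\<in>facets \<Delta>. v \<in> F)"
    and p: "p \<in> subfree_pairs \<Delta>"
  obtains q where "q \<in> free_pairs \<Delta>" "pair_le p q"
proof -
  obtain A C where AC: "p = (A, C)" "A \<in> \<Delta>" "C \<noteq> {}" "A \<inter> C = {}"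
    "C \<subseteq> \<Inter>{H \<in> facets \<Delta>. A \<subseteq> H}"
    using p by (auto simp: subfree_pairs_def)
  let ?cl = "\<Inter>{H \<in> facets \<Delta>. A \<subseteq> H}"
  \<comment> \<open>This keeps the intersection \<open>?cl\<close> from being taken over the empty
    family, where it would be \<open>UNIV\<close>.\<close>
  obtain H where H: "H \<in> facets \<Delta>" "A \<subseteq> H" using face_in_facet[OF AC(2)] .
  have "?cl \<in> \<Delta>"
  proof -
    have "?cl \<subseteq> H" using H by blast
    moreover have "H \<in> \<Delta>" using H(1) by (simp add: facets_def)
    ultimately show ?thesis using \<Delta> unfolding simplicial_complex_def by blast
  qed
  moreover have "A \<union> (?cl - A) = ?cl" by blast
  \<comment> \<open>If \<open>A\<close> were empty, every vertex of the non-empty set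
    \<open>C\<close> would lie in all facets.\<close>
  moreover have "A \<noteq> {}" using core AC(3,5) by blast
  moreover have "?cl - A \<noteq> {}" using AC(3-5) by blast
  ultimately have "(A, ?cl - A) \<in> free_pairs \<Delta>"
    unfolding free_pairs_def mem_Collect_eq prod.case by (metis Diff_disjoint)
  moreover have "pair_le p (A, ?cl - A)"
    unfolding pair_le_def AC(1) fst_conv snd_conv using AC(4,5) by blast
  ultimately show thesis by (rule that)
qed

section \<open>Translation between exponent vectors and pairs\<close>

definition pair_of_exponent :: "('n \<Rightarrow>\<^sub>0 nat) \<Rightarrow> 'n set \<times> 'n set" where
  "pair_of_exponent a = ({i. 2 \<le> Poly_Mapping.lookup a i}, {i. Poly_Mapping.lookup a i = 0})"

definition exponent_of_pair :: "'n::finite set \<times> 'n set \<Rightarrow> 'n \<Rightarrow>\<^sub>0 nat" where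
  "exponent_of_pair p = indicator_exponent (fst p) + indicator_exponent (- snd p)"

lemma lookup_exponent_of_pair:
  "Poly_Mapping.lookup (exponent_of_pair p) i =
    (if i \<in> fst p then 1 else 0) + (if i \<in> snd p then 0 else 1)"
  by (simp add: exponent_of_pair_def lookup_add lookup_indicator_exponent)

lemma pair_of_exponent_of_pair:
  "fst p \<inter> snd p = {} \<Longrightarrow> pair_of_exponent (exponent_of_pair p) = p"
  by (cases p) (auto simp: pair_of_exponent_def lookup_exponent_of_pair split: if_splits)

text \<open>The round trip caps every exponent at 2, so it passes to a divisor with the same
  pair.\<close>

lemma exponent_of_pair_of_exponent_le:
  "Poly_Mapping.lookup (exponent_of_pair (pair_of_exponent a)) i \<le> Poly_Mapping.lookup a i"
  by (simp add: pair_of_exponent_def lookup_exponent_of_pair)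

lemma exponent_of_pair_mono:
  "pair_le p q \<Longrightarrow>
    Poly_Mapping.lookup (exponent_of_pair q) i \<le> Poly_Mapping.lookup (exponent_of_pair p) i"
  by (auto simp: pair_le_def lookup_exponent_of_pair)

lemma pair_of_exponent_mono:
  assumes "\<And>i. Poly_Mapping.lookup b i \<le> Poly_Mapping.lookup a i"
  shows "pair_le (pair_of_exponent a) (pair_of_exponent b)"
  unfolding pair_le_def pair_of_exponent_def
  using assms by (auto intro: order_trans) (metis le_zero_eq)

section \<open>Minimal generators of \<open>J1\<close> in terms of pairs\<close>

lemma single_J1_generator_iff:
  fixes \<Delta> :: "'n::finite set set"
  assumes "simplicial_complex \<Delta>"
  defines "m \<equiv> \<lambda>a. Poly_Mapping.single a 1 :: ('n, 'k::field) poly_ring"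
  shows "m a \<in> ideal_colon (square_ideal (SR_ideal \<Delta>)) (SR_ideal \<Delta>) \<and>
     m a \<notin> ideal_sum (square_ideal (SR_ideal \<Delta>)) (ideal_gen {\<Prod>i\<in>UNIV. Var i}) \<longleftrightarrow>
   pair_of_exponent a \<in> subfree_pairs \<Delta>"
proof -
  let ?A = "{i. 2 \<le> Poly_Mapping.lookup a i}" and ?C = "{i. Poly_Mapping.lookup a i = 0}"
  have C: "{i. Poly_Mapping.lookup a i \<noteq> 0} = - ?C" by auto
  have AC: "?A \<inter> ?C = {}" by auto
  show ?thesis
    unfolding m_def single_in_ideal_colon_iff[OF assms(1)] single_in_ideal_sum_iff[OF assms(1)] C
    \<comment> \<open>Lying outside the ideal sum supplies both \<open>?A \<in> \<Delta>\<close>,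
      the open premise here, and \<open>?C \<noteq> {}\<close>.\<close>
    using colon_condition_iff[OF assms(1) _ AC] AC
    unfolding pair_of_exponent_def subfree_pairs_def by blast
qed

text \<open>Every monomial of the ideal is a multiple of some element of \<open>B\<close>, so
  minimality need only be tested against \<open>B\<close>.\<close>

lemma minimal_monomial_generators_ideal_gen:
  fixes B :: "('n::finite, 'k::field) poly_ring set"
  assumes B: "B \<subseteq> monomials"
  shows "minimal_monomial_generators (ideal_gen B) = {m \<in> B. \<forall>m'\<in>B. m' dvd m \<longrightarrow> m' = m}"
    (is "?M = ?N")
proof
  show "?M \<subseteq> ?N"
    using unique_minimal_monomial_generating_set(3)[OF refl B B refl] B ideal_gen_base[of _ B]
    by (auto simp: minimal_monomial_generators_def)
  show "?N \<subseteq> ?M"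
  proof
    fix m assume m: "m \<in> ?N"
    have "m' = m" if m': "m' \<in> monomials" "m' \<in> ideal_gen B" "m' dvd m" for m'
    proof -
      obtain b where b: "b \<in> B" "b dvd m'" using monomial_in_monomial_ideal[OF B m'(1,2)] by blast
      then have "b = m" using m m'(3) dvd_trans by blast
      then show ?thesis using b(2) m m' B monomial_dvd_antisym by blast
    qed
    then show "m \<in> ?M"
      using m B ideal_gen_base[of _ B] by (auto simp: minimal_monomial_generators_def)
  qed
qed

lemma single_in_minimal_monomial_generators_J1_iff:
  fixes \<Delta> :: "'n::finite set set"
  assumes "simplicial_complex \<Delta>"
  shows "Poly_Mapping.single a 1 \<in>
      minimal_monomial_generators (J1 \<Delta> :: ('n, 'k::field) poly_ring set) \<longleftrightarrow>
    pair_of_exponent a \<in> subfree_pairs \<Delta> \<and>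
    (\<forall>b. pair_of_exponent b \<in> subfree_pairs \<Delta> \<longrightarrow>
      (\<forall>i. Poly_Mapping.lookup b i \<le> Poly_Mapping.lookup a i) \<longrightarrow> b = a)"
proof -
  let ?s = "\<lambda>a. Poly_Mapping.single a 1 :: ('n, 'k) poly_ring"
  have "J1 \<Delta> = ideal_gen {m :: ('n, 'k) poly_ring. \<exists>a. m = ?s a \<and>
      pair_of_exponent a \<in> subfree_pairs \<Delta>}"
    unfolding J1_def single_J1_generator_iff[OF assms, where 'k='k, symmetric]
    by (rule arg_cong[where f = ideal_gen]) (auto simp: monomials_def)
  moreover have "{m :: ('n, 'k) poly_ring. \<exists>a. m = ?s a \<and>
      pair_of_exponent a \<in> subfree_pairs \<Delta>} \<subseteq> monomials"
    by (auto simp: monomials_def)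
  ultimately show ?thesis
    by (auto simp: minimal_monomial_generators_ideal_gen single_dvd_single_iff
        single_eq_single_iff)
qed

section \<open>The bijection\<close>

lemma bij_betw_maximal_free_pairs:
  fixes \<Delta> :: "'n::finite set set"
  assumes \<Delta>: "simplicial_complex \<Delta>" and core: "\<not> (\<exists>v. \<forall>F\<in>facets \<Delta>. v \<in> F)"
  shows "bij_betw (\<lambda>p. Poly_Mapping.single (exponent_of_pair p) 1) (maximal_free_pairs \<Delta>)
    (minimal_monomial_generators (J1 \<Delta> :: ('n, 'k::field) poly_ring set))"
    (is "bij_betw ?f ?P ?M")
proof -
  have pe: "pair_of_exponent (exponent_of_pair p) = p" if "p \<in> subfree_pairs \<Delta>" for p
    using that by (intro pair_of_exponent_of_pair) (auto simp: subfree_pairs_def)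
  have free: "p \<in> subfree_pairs \<Delta>" if "p \<in> free_pairs \<Delta>" for p
    using free_pairs_subset_subfree_pairs[OF \<Delta>] that by blast
  note min_iff = single_in_minimal_monomial_generators_J1_iff[OF \<Delta>, where 'k='k]
  have inj: "inj_on ?f ?P"
  proof (rule inj_onI)
    fix p q assume "p \<in> ?P" "q \<in> ?P" and "?f p = ?f q"
    then show "p = q"
      using pe free unfolding maximal_free_pairs_def single_eq_single_iff
      by (metis (no_types, lifting) mem_Collect_eq)
  qed
  have into: "?f p \<in> ?M" if p: "p \<in> ?P" for p
    unfolding min_iff
  proof (intro conjI allI impI)
    have pf: "p \<in> free_pairs \<Delta>" using p by (simp add: maximal_free_pairs_def)
    then show "pair_of_exponent (exponent_of_pair p) \<in> subfree_pairs \<Delta>"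
      using pe free by simp
    fix b assume b: "pair_of_exponent b \<in> subfree_pairs \<Delta>"
      and le: "\<forall>i. Poly_Mapping.lookup b i \<le> Poly_Mapping.lookup (exponent_of_pair p) i"
    have pb: "pair_le p (pair_of_exponent b)"
      using pair_of_exponent_mono[of b "exponent_of_pair p"] le pe[OF free[OF pf]] by simp
    obtain q where q: "q \<in> free_pairs \<Delta>" "pair_le (pair_of_exponent b) q"
      using subfree_pair_le_free_pair[OF \<Delta> core b] .
    have "pair_le p q" using pb q(2) unfolding pair_le_def by blast
    then have "q = p" using p q(1) by (simp add: maximal_free_pairs_def)
    \<comment> \<open>The pair of \<open>b\<close> is squeezed between \<open>p\<close> and
      \<open>q\<close>, which coincide.\<close>
    then have "pair_of_exponent b = p"
      using pb q(2) by (auto simp: pair_le_def prod_eq_iff)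
    \<comment> \<open>Now \<open>b\<close> lies above its own capped vector, which is
      \<open>exponent_of_pair p\<close>, and below it by \<open>le\<close>.\<close>
    then show "b = exponent_of_pair p"
      using exponent_of_pair_of_exponent_le[of b] le
      by (intro poly_mapping_eqI antisym) auto
  qed
  have onto: "m \<in> ?f ` ?P" if m: "m \<in> ?M" for m
  proof -
    obtain a where a: "m = Poly_Mapping.single a 1"
      using m by (auto simp: minimal_monomial_generators_def monomials_def)
    have sub: "pair_of_exponent a \<in> subfree_pairs \<Delta>"
      and min: "\<And>b. pair_of_exponent b \<in> subfree_pairs \<Delta> \<Longrightarrow>
        (\<And>i. Poly_Mapping.lookup b i \<le> Poly_Mapping.lookup a i) \<Longrightarrow> b = a"
      using m unfolding a min_iff by blast+
    obtain q where q: "q \<in> free_pairs \<Delta>" "pair_le (pair_of_exponent a) q"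
      using subfree_pair_le_free_pair[OF \<Delta> core sub] .
    \<comment> \<open>Passing to larger pairs lowers exponents, so any free pair above
      \<open>q\<close> gives a divisor of the minimal generator and must reproduce \<open>a\<close>.
      Taking \<open>r = q\<close> identifies \<open>a\<close>; for other \<open>r\<close>,
      recovering the pair from \<open>a\<close> forces \<open>r = q\<close>, which is
      maximality.\<close>
    have above: "exponent_of_pair r = a" if r: "r \<in> free_pairs \<Delta>" "pair_le q r" for r
    proof (rule min)
      show "pair_of_exponent (exponent_of_pair r) \<in> subfree_pairs \<Delta>"
        using r(1) pe free by simp
      have "pair_le (pair_of_exponent a) r" using q(2) r(2) unfolding pair_le_def by blast
      then show "Poly_Mapping.lookup (exponent_of_pair r) i \<le> Poly_Mapping.lookup a i" for i
        using exponent_of_pair_mono exponent_of_pair_of_exponent_le order_trans by blast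
    qed
    have qa: "exponent_of_pair q = a" using above[OF q(1)] by (simp add: pair_le_def)
    have "r = q" if "r \<in> free_pairs \<Delta>" "pair_le q r" for r
      using pe[OF free[OF that(1)]] pe[OF free[OF q(1)]] above[OF that] qa by simp
    then have "q \<in> ?P" using q(1) by (simp add: maximal_free_pairs_def)
    with qa show ?thesis unfolding a by blast
  qed
  show ?thesis using inj into onto unfolding bij_betw_def by blast
qed

theorem theorem1p1:
  fixes \<Delta> :: "'n::finite set set"
  assumes "simplicial_complex \<Delta>"
    and "\<not> (\<exists>v. \<forall>F\<in>facets \<Delta>. v \<in> F)"
  shows "(\<exists>\<phi>. bij_betw \<phi> (minimal_monomial_generators (J1 \<Delta> :: ('n, 'k::field) poly_ring set))
                (maximal_free_pairs \<Delta>)) \<and>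
         card (maximal_free_pairs \<Delta>) =
           card (minimal_monomial_generators (J1 \<Delta> :: ('n, 'k) poly_ring set))"
  using bij_betw_maximal_free_pairs[OF assms, where 'k='k] bij_betw_inv bij_betw_same_card
  by blast

end
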